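(* Let $L$ be a decomposable lattice and let $P$ be an ideal of $L$ with $P\neq L$. The following conditions are equivalent: (1) $P$ is a prime ideal of $L$. (2) For all $x,y\in L$, if $x\wedge y=0$ then $x\in P$ or $y\in P$. (3) For all $x,y$: $x,y\in L\setminus P$ implies $x\wedge y\in L\setminus P$. (4) For all ideals $I,J$ of $L$, if $I\cap J\subseteq P$ then $I\subseteq P$ or $J\subseteq P$. (5) For all ideals $I,J$ of $L$ with $P\subseteq I$ and $P\subseteq J$, either $I\subseteq J$ or $J\subseteq I$.
   Context: A decomposable lattice is a distributive lattice $L$ with minimum element $0$ such that for any $a,b\in L$ that are not comparable there exist $\overline{a},\overline{b}\in L$ with $a=\overline{a}\vee(a\wedge b)$, $b=\overline{b}\vee(a\wedge b)$ and $\overline{a}\wedge\overline{b}=0$. An ideal of $L$ is a nonempty subset closed under $\vee$ and downward closed. An ideal $P$ is prime if $P\neq L$ and $a\wedge b\in P$ implies $a\in P$ or $b\in P$. *)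

theory Defs
  imports Main
begin

class decomposable_lattice = distrib_lattice + order_bot +
  assumes decomposable:
    "\<not> a \<le> b \<Longrightarrow> \<not> b \<le> a \<Longrightarrow>
      \<exists>a' b'. a = sup a' (inf a b) \<and> b = sup b' (inf a b) \<and> inf a' b' = bot"

definition lattice_ideal :: "'a::lattice set \<Rightarrow> bool" where
  "lattice_ideal I \<longleftrightarrow>
     I \<noteq> {} \<and>
     (\<forall>x\<in>I. \<forall>y\<in>I. sup x y \<in> I) \<and>
     (\<forall>x\<in>I. \<forall>y. y \<le> x \<longrightarrow> y \<in> I)"

definition prime_lattice_ideal :: "'a::lattice set \<Rightarrow> bool" where
  "prime_lattice_ideal P \<longleftrightarrow>
     lattice_ideal P \<and> P \<noteq> UNIV \<and>
     (\<forall>a b. inf a b \<in> P \<longrightarrow> a \<in> P \<or> b \<in> P)"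

end

theory Submission
  imports Defs
begin

text \<open>
  Two kinds of argument meet here. The conditions on meets and on intersections of ideals are
  equivalent to primeness in every lattice, since a meet is the intersection of the principal
  ideals below its factors.

  Decomposability enters through one observation: subtracting the common part \<open>inf a b\<close> from
  two incomparable elements leaves a disjoint pair \<open>a'\<close>, \<open>b'\<close>, and an ideal that contains
  \<open>inf a b\<close> contains \<open>a\<close> as soon as it contains \<open>a'\<close>. Hence it is enough to test
  primeness on disjoint pairs. Similarly, if \<open>I\<close> and \<open>J\<close> both contain a prime ideal \<open>P\<close> and
  \<open>x \<in> I - J\<close>, \<open>y \<in> J - I\<close>, then \<open>P\<close> contains one of the two remainders of \<open>x\<close> and
  \<open>y\<close>, and adding back \<open>inf x y\<close>, which lies in \<open>I \<inter> J\<close>, puts \<open>x\<close> into \<open>J\<close> or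
  \<open>y\<close> into \<open>I\<close>; so the ideals above a prime ideal form a chain.

  Conversely, if the ideals above \<open>P\<close> form a chain, then the ideals generated by \<open>P\<close> with \<open>a\<close>
  and by \<open>P\<close> with \<open>b\<close> are comparable, say \<open>a \<le> sup p b\<close> with \<open>p \<in> P\<close>. Meeting with
  \<open>a\<close> and distributing shows that \<open>a\<close> belongs to \<open>P\<close> whenever \<open>inf a b\<close> does.
\<close>

lemma lattice_ideal_sup:
  "lattice_ideal I \<Longrightarrow> x \<in> I \<Longrightarrow> y \<in> I \<Longrightarrow> sup x y \<in> I"
  by (simp add: lattice_ideal_def)

lemma lattice_ideal_downward:
  "lattice_ideal I \<Longrightarrow> x \<in> I \<Longrightarrow> y \<le> x \<Longrightarrow> y \<in> I"
  unfolding lattice_ideal_def by blast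

lemma bot_in_lattice_ideal:
  fixes I :: "'a::{lattice, order_bot} set"
  shows "lattice_ideal I \<Longrightarrow> bot \<in> I"
  unfolding lattice_ideal_def using bot_least by blast

lemma lattice_ideal_principal: "lattice_ideal {..a}"
  unfolding lattice_ideal_def by (auto intro: order_trans)

text \<open>
  The set below is the ideal generated by \<open>P\<close> and \<open>a\<close>: every element of that ideal is bounded
  by a join of finitely many members of \<open>P\<close> with \<open>a\<close>, and the members of \<open>P\<close> can be joined
  into a single \<open>p\<close>.
\<close>

lemma lattice_ideal_adjoin:
  assumes P: "lattice_ideal P"
  shows "lattice_ideal {z. \<exists>p\<in>P. z \<le> sup p a}"
proof -
  have "sup x y \<le> sup (sup p q) a" if "x \<le> sup p a" "y \<le> sup q a" for x y p q
  proof (rule sup_least)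
    show "x \<le> sup (sup p q) a"
      using that(1) by (rule order_trans) (simp add: le_supI1)
    show "y \<le> sup (sup p q) a"
      using that(2) by (rule order_trans) (simp add: le_supI1)
  qed
  moreover have "P \<noteq> {}"
    using P by (simp add: lattice_ideal_def)
  ultimately show ?thesis
    using lattice_ideal_sup[OF P] unfolding lattice_ideal_def
    by (auto intro: order_trans) blast+
qed

text \<open>
  If \<open>x \<in> I - P\<close> and \<open>y \<in> J - P\<close>, then \<open>inf x y\<close> lies in \<open>I \<inter> J\<close> but not in a prime
  ideal \<open>P\<close>. Conversely, the intersection of the principal ideals of \<open>a\<close> and \<open>b\<close> is the
  principal ideal of \<open>inf a b\<close>.
\<close>

lemma prime_iff_ideal_Int:
  assumes P: "lattice_ideal P" and proper: "P \<noteq> UNIV"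
  shows "prime_lattice_ideal P \<longleftrightarrow>
    (\<forall>I J. lattice_ideal I \<and> lattice_ideal J \<and> I \<inter> J \<subseteq> P \<longrightarrow> I \<subseteq> P \<or> J \<subseteq> P)"
    (is "_ \<longleftrightarrow> ?ideals")
proof
  assume prime: "prime_lattice_ideal P"
  show ?ideals
  proof (intro allI impI, elim conjE, rule ccontr)
    fix I J
    assume I: "lattice_ideal I" and J: "lattice_ideal J" and IJ: "I \<inter> J \<subseteq> P"
      and "\<not> (I \<subseteq> P \<or> J \<subseteq> P)"
    then obtain x y where x: "x \<in> I" "x \<notin> P" and y: "y \<in> J" "y \<notin> P"
      by blast
    have "inf x y \<in> I \<inter> J"
      using lattice_ideal_downward[OF I x(1)] lattice_ideal_downward[OF J y(1)] by simp
    then show False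
      using IJ prime x(2) y(2) unfolding prime_lattice_ideal_def by blast
  qed
next
  assume ideals: ?ideals
  have "a \<in> P \<or> b \<in> P" if ab: "inf a b \<in> P" for a b
  proof -
    have "{..a} \<inter> {..b} \<subseteq> P"
      using lattice_ideal_downward[OF P ab] by auto
    then have "{..a} \<subseteq> P \<or> {..b} \<subseteq> P"
      using ideals lattice_ideal_principal by blast
    then show ?thesis by auto
  qed
  then show "prime_lattice_ideal P"
    using P proper unfolding prime_lattice_ideal_def by blast
qed

text \<open>
  The remainders of two incomparable elements are disjoint, so one of them lies in \<open>P\<close>; joining
  it with \<open>inf a b\<close> recovers the original element.
\<close>

lemma prime_iff_disjoint_pairs:
  fixes P :: "'a::decomposable_lattice set"
  assumes P: "lattice_ideal P" and proper: "P \<noteq> UNIV"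
  shows "prime_lattice_ideal P \<longleftrightarrow> (\<forall>x y. inf x y = bot \<longrightarrow> x \<in> P \<or> y \<in> P)"
    (is "_ \<longleftrightarrow> ?disjoint")
proof
  assume "prime_lattice_ideal P"
  then show ?disjoint
    using bot_in_lattice_ideal[OF P] unfolding prime_lattice_ideal_def by metis
next
  assume disjoint: ?disjoint
  have "a \<in> P \<or> b \<in> P" if ab: "inf a b \<in> P" for a b
  proof (cases "a \<le> b \<or> b \<le> a")
    case True
    then show ?thesis
      using ab by (auto simp: inf_absorb1 inf_absorb2)
  next
    case False
    then obtain a' b' where a: "a = sup a' (inf a b)" and b: "b = sup b' (inf a b)"
      and "inf a' b' = bot"
      using decomposable by blast
    then have "a' \<in> P \<or> b' \<in> P"
      using disjoint by blast
    then show ?thesis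
      using lattice_ideal_sup[OF P _ ab] a b by metis
  qed
  then show "prime_lattice_ideal P"
    using P proper unfolding prime_lattice_ideal_def by blast
qed

text \<open>
  An element \<open>x\<close> of \<open>I\<close> outside \<open>J\<close> and an element \<open>y\<close> of \<open>J\<close> outside \<open>I\<close> are
  incomparable, and \<open>inf x y\<close> lies in both ideals. The remainder that \<open>P\<close> contains also lies in
  both, which brings \<open>x\<close> or \<open>y\<close> into the wrong ideal.
\<close>

lemma ideals_above_prime_chain:
  fixes P :: "'a::decomposable_lattice set"
  assumes prime: "prime_lattice_ideal P"
    and I: "lattice_ideal I" and J: "lattice_ideal J"
    and PI: "P \<subseteq> I" and PJ: "P \<subseteq> J"
  shows "I \<subseteq> J \<or> J \<subseteq> I"
proof (rule ccontr)
  assume "\<not> (I \<subseteq> J \<or> J \<subseteq> I)"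
  then obtain x y where x: "x \<in> I" "x \<notin> J" and y: "y \<in> J" "y \<notin> I"
    by blast
  have "\<not> x \<le> y" and "\<not> y \<le> x"
    using lattice_ideal_downward[OF I x(1)] lattice_ideal_downward[OF J y(1)] x(2) y(2)
    by blast+
  then obtain x' y' where x': "x = sup x' (inf x y)" and y': "y = sup y' (inf x y)"
    and disjoint: "inf x' y' = bot"
    using decomposable by blast
  have "lattice_ideal P"
    using prime by (simp add: prime_lattice_ideal_def)
  then have "x' \<in> P \<or> y' \<in> P"
    using prime bot_in_lattice_ideal disjoint unfolding prime_lattice_ideal_def by metis
  moreover have "inf x y \<in> I" and "inf x y \<in> J"
    using lattice_ideal_downward[OF I x(1)] lattice_ideal_downward[OF J y(1)] by simp_all
  ultimately have "x \<in> J \<or> y \<in> I"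
    using lattice_ideal_sup[OF I] lattice_ideal_sup[OF J] PI PJ x' y' by (metis subsetD)
  then show False
    using x(2) y(2) by blast
qed

text \<open>
  Distributivity gives \<open>a = inf a (sup p b) = sup (inf a p) (inf a b)\<close>, a join of two members
  of \<open>P\<close>.
\<close>

lemma in_ideal_if_le_sup:
  fixes P :: "'a::distrib_lattice set"
  assumes P: "lattice_ideal P" and ab: "inf a b \<in> P"
    and p: "p \<in> P" and le: "a \<le> sup p b"
  shows "a \<in> P"
proof -
  have "inf a p \<in> P"
    using lattice_ideal_downward[OF P p] by simp
  then have "sup (inf a p) (inf a b) \<in> P"
    using ab by (rule lattice_ideal_sup[OF P])
  then show ?thesis
    using le by (simp add: inf_sup_distrib1[symmetric] inf_absorb1)
qed

lemma prime_if_ideals_above_chain: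
  fixes P :: "'a::distrib_lattice set"
  assumes P: "lattice_ideal P" and proper: "P \<noteq> UNIV"
    and chain: "\<And>I J. lattice_ideal I \<Longrightarrow> lattice_ideal J \<Longrightarrow> P \<subseteq> I \<Longrightarrow> P \<subseteq> J
      \<Longrightarrow> I \<subseteq> J \<or> J \<subseteq> I"
  shows "prime_lattice_ideal P"
proof -
  have "a \<in> P \<or> b \<in> P" if ab: "inf a b \<in> P" for a b
  proof -
    define adjoin where "adjoin c = {z. \<exists>p\<in>P. z \<le> sup p c}" for c
    have ideal: "lattice_ideal (adjoin c)" for c
      unfolding adjoin_def by (rule lattice_ideal_adjoin[OF P])
    have above: "P \<subseteq> adjoin c" for c
      unfolding adjoin_def using sup_ge1 by blast
    have self: "c \<in> adjoin c" for c
      using P unfolding adjoin_def lattice_ideal_def by auto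
    have "a \<in> adjoin b \<or> b \<in> adjoin a"
      using chain[OF ideal ideal above above] self by blast
    then show ?thesis
    proof
      assume "a \<in> adjoin b"
      then show ?thesis
        using in_ideal_if_le_sup[OF P ab] unfolding adjoin_def by blast
    next
      assume "b \<in> adjoin a"
      moreover have "inf b a \<in> P"
        using ab by (simp add: inf_commute)
      ultimately show ?thesis
        using in_ideal_if_le_sup[OF P] unfolding adjoin_def by blast
    qed
  qed
  then show ?thesis
    using P proper unfolding prime_lattice_ideal_def by blast
qed

theorem theorem3p1:
  fixes P :: "'a::decomposable_lattice set"
  assumes "lattice_ideal P" and "P \<noteq> UNIV"
  shows "(prime_lattice_ideal P \<longleftrightarrow>
            (\<forall>x y. inf x y = bot \<longrightarrow> x \<in> P \<or> y \<in> P))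
       \<and> (prime_lattice_ideal P \<longleftrightarrow>
            (\<forall>x y. x \<in> UNIV - P \<and> y \<in> UNIV - P \<longrightarrow> inf x y \<in> UNIV - P))
       \<and> (prime_lattice_ideal P \<longleftrightarrow>
            (\<forall>I J. lattice_ideal I \<and> lattice_ideal J \<and> I \<inter> J \<subseteq> P
               \<longrightarrow> I \<subseteq> P \<or> J \<subseteq> P))
       \<and> (prime_lattice_ideal P \<longleftrightarrow>
            (\<forall>I J. lattice_ideal I \<and> lattice_ideal J \<and> P \<subseteq> I \<and> P \<subseteq> J
               \<longrightarrow> I \<subseteq> J \<or> J \<subseteq> I))"
proof (intro conjI)
  show "prime_lattice_ideal P \<longleftrightarrow> (\<forall>x y. inf x y = bot \<longrightarrow> x \<in> P \<or> y \<in> P)"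
    using assms by (rule prime_iff_disjoint_pairs)
  show "prime_lattice_ideal P \<longleftrightarrow>
      (\<forall>x y. x \<in> UNIV - P \<and> y \<in> UNIV - P \<longrightarrow> inf x y \<in> UNIV - P)"
    using assms unfolding prime_lattice_ideal_def by blast
  show "prime_lattice_ideal P \<longleftrightarrow>
      (\<forall>I J. lattice_ideal I \<and> lattice_ideal J \<and> I \<inter> J \<subseteq> P \<longrightarrow> I \<subseteq> P \<or> J \<subseteq> P)"
    using assms by (rule prime_iff_ideal_Int)
  show "prime_lattice_ideal P \<longleftrightarrow>
      (\<forall>I J. lattice_ideal I \<and> lattice_ideal J \<and> P \<subseteq> I \<and> P \<subseteq> J
         \<longrightarrow> I \<subseteq> J \<or> J \<subseteq> I)"
    using ideals_above_prime_chain prime_if_ideals_above_chain[OF assms] by blast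
qed

end
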